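(* Let $y^{(n)}=F(x,y,y',\dots,y^{(n-1)})$ be an $n$th order ODE. The generalised W\"unschmann conditions $C_k=0$, $k=1,\dots,n-2$, hold for $F$ if and only if all the Doubrov invariants $L_k$, $k=1,\dots,n-2$, of the ODE vanish.
   Context: All considerations are local and smooth. Notation: $F_i=\partial F/\partial y^{(i)}$, $i=0,\dots,n-1$, and $$\frac{\mathrm{d}}{\mathrm{d}x}=\frac{\partial}{\partial x}+\sum_{k=1}^{n-1}y^{(k)}\frac{\partial}{\partial y^{(k-1)}}+F\frac{\partial}{\partial y^{(n-1)}},$$ also denoted by a prime. Generalised W\"unschmann conditions. Put $$Q=\frac{2}{n(n-1)}F_{n-1},\qquad P=\frac{1}{n(n^2-1)}\Big(\frac{(3n-1)(n-2)}{n(n-1)}F_{n-1}^2+6F_{n-2}-2(n-2)\frac{\mathrm{d}}{\mathrm{d}x}F_{n-1}\Big).$$ Define $a_{ik}$ for $0\le i\le n$ by $a_{00}=1$, $a_{ik}=0$ for $k>i$ or $k<0$, and $$a_{(i+1)k}=(a_{ik})'+kQ\,a_{ik}+(n-k)\,a_{i(k-1)}+(k+1)P\,a_{i(k+1)} .$$ (Equivalently: if $\mathbf{q}=\mathbf{p}'$, $\mathbf{q}'=P\mathbf{p}+Q\mathbf{q}$ and $\mathbf{E}=\mathbf{p}^{n-1}$, then $\mathbf{E}^{(i)}=\sum_k a_{ik}\mathbf{p}^{n-1-k}\mathbf{q}^k$.) The equations $a_{nj}=\sum_{i=0}^{n-1}F_ia_{ij}$ for $j=n-1$ and $j=n-2$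 are then satisfied identically (they determine $Q$ and $P$); the remaining $n-2$ equations $$a_{nj}-\sum_{i=0}^{n-1}F_i\,a_{ij}=0,\qquad j=0,\dots,n-3,$$ are the generalised W\"unschmann conditions $C_k(F_i,\mathrm{d}F_i/\mathrm{d}x,\dots,\mathrm{d}^{n-1}F_i/\mathrm{d}x^{n-1})=0$, $k=1,\dots,n-2$. They are equivalent to the existence, on the solution space $M$, of a bundle isomorphism $TM\cong S^{n-1}(\mathbb{S})$ with $\mathbb{S}$ a real rank-two bundle, such that for the general solution $y=Z(x,t)$ the normals to the hypersurfaces $\{t\in M:Z(x,t)=y\}$ are $(n-1)$th powers. Wilczynski invariants. For a linear homogeneous ODE $y^{(n)}=p_{n-1}(x)y^{(n-1)}+\dots+p_0(x)y$, the classical Wilczynski invariants are $n-2$ universal polynomial expressions $\theta_k(p_i,\mathrm{d}p_i/\mathrm{d}x,\dots,\mathrm{d}^{n-1}p_i/\mathrm{d}x^{n-1})$, $k=1,\dots,n-2$, whose simultaneous vanishing is equivalent to each of: (a) the ODE can be transformed to $y^{(n)}=0$ by a change of variables $(y,x)\to(a(x)y,b(x))$; (b) for any basis $y_1,\dots,y_n$ of its solution space, the curve $x\mapsto[y_1(x):\dots:y_n(x)]\in\mathbb{RP}^{n-1}$ is an open subset of a rational normal curve. Doubrov invariants. For the ODE $y^{(n)}=F$ they are the expressions $L_k=\theta_k(F_i,\mathrm{d}F_i/\mathrm{d}x,\dots,\mathrm{d}^{n-1}F_i/\mathrm{d}x^{n-1})$, $k=1,\dots,n-2$, obtained by replacing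 $p_i(x)$ by $F_i$ and $x$-derivatives by the total derivative. Thus, restricted to any solution $y=Y(x)$, they are the Wilczynski invariants of the linearisation $v^{(n)}=\sum_{i=0}^{n-1}F_i|_{y=Y}\,v^{(i)}$ at this solution, and all $L_k$ vanish if and only if for every solution this linearisation has vanishing Wilczynski invariants. *)

theory Defs
  imports "HOL-Analysis.Analysis"
begin

text \<open>
  The space with coordinates $(x, y, y', \dots, y^{(n-1)})$ is realised as the copy of
  $\mathbb{R}^{n+1}$ inside \<^typ>\<open>nat \<Rightarrow> real\<close> consisting of the points supported on the
  indices \<open>0, \<dots>, n\<close>: index \<open>0\<close> is $x$ and index \<open>Suc i\<close> is $y^{(i)}$. The topology that
  it inherits from the product topology is the Euclidean one.
\<close>

definition jet_space :: "nat \<Rightarrow> (nat \<Rightarrow> real) set" where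
  "jet_space n = {z. \<forall>i>n. z i = 0}"

definition pd :: "nat \<Rightarrow> ((nat \<Rightarrow> real) \<Rightarrow> real) \<Rightarrow> (nat \<Rightarrow> real) \<Rightarrow> real" where
  "pd i g z = deriv (\<lambda>t. g (z(i := t))) (z i)"

text \<open>
  Smoothness on an open subset \<open>U\<close> of \<^term>\<open>jet_space n\<close>: all iterated partial derivatives exist
  and are continuous. The list \<open>is\<close> is the sequence of directions of differentiation.
\<close>

definition smooth_on_jets :: "nat \<Rightarrow> (nat \<Rightarrow> real) set \<Rightarrow> ((nat \<Rightarrow> real) \<Rightarrow> real) \<Rightarrow> bool" where
  "smooth_on_jets n U g \<longleftrightarrow>
     (\<forall>is. set is \<subseteq> {..n} \<longrightarrow>
        continuous_on U (foldr pd is g) \<and>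
        (\<forall>z\<in>U. \<forall>i\<le>n. (\<lambda>t. foldr pd is g (z(i := t))) field_differentiable at (z i)))"

definition total_deriv ::
    "nat \<Rightarrow> ((nat \<Rightarrow> real) \<Rightarrow> real) \<Rightarrow> ((nat \<Rightarrow> real) \<Rightarrow> real) \<Rightarrow> (nat \<Rightarrow> real) \<Rightarrow> real" where
  "total_deriv n F g z =
     pd 0 g z + (\<Sum>k = 1..n - 1. z (Suc k) * pd (Suc (k - 1)) g z) + F z * pd (Suc (n - 1)) g z"

definition Fpart :: "((nat \<Rightarrow> real) \<Rightarrow> real) \<Rightarrow> nat \<Rightarrow> (nat \<Rightarrow> real) \<Rightarrow> real" where
  "Fpart F i = pd (Suc i) F"

definition wue_Q :: "nat \<Rightarrow> ((nat \<Rightarrow> real) \<Rightarrow> real) \<Rightarrow> (nat \<Rightarrow> real) \<Rightarrow> real" where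
  "wue_Q n F z = 2 / (real n * (real n - 1)) * Fpart F (n - 1) z"

definition wue_P :: "nat \<Rightarrow> ((nat \<Rightarrow> real) \<Rightarrow> real) \<Rightarrow> (nat \<Rightarrow> real) \<Rightarrow> real" where
  "wue_P n F z =
     1 / (real n * ((real n)\<^sup>2 - 1)) *
       ((3 * real n - 1) * (real n - 2) / (real n * (real n - 1)) * (Fpart F (n - 1) z)\<^sup>2
        + 6 * Fpart F (n - 2) z
        - 2 * (real n - 2) * total_deriv n F (Fpart F (n - 1)) z)"

text \<open>
  \<open>wue_a n F i k\<close> is $a_{ik}$. The entries with $k < 0$ are zero, which is why one term is
  dropped for \<open>k = 0\<close>; the entries with $k > i$ come out as zero from the recursion.
\<close>

primrec wue_a :: "nat \<Rightarrow> ((nat \<Rightarrow> real) \<Rightarrow> real) \<Rightarrow> nat \<Rightarrow> nat \<Rightarrow> (nat \<Rightarrow> real) \<Rightarrow> real" where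
  "wue_a n F 0 = (\<lambda>k z. if k = 0 then 1 else 0)"
| "wue_a n F (Suc i) = (\<lambda>k z.
     total_deriv n F (wue_a n F i k) z
     + real k * wue_Q n F z * wue_a n F i k z
     + (if k = 0 then 0 else (real n - real k) * wue_a n F i (k - 1) z)
     + (real k + 1) * wue_P n F z * wue_a n F i (k + 1) z)"

text \<open>$C_k$ for $k = 1, \dots, n-2$ is the equation with $j = k - 1 \in \{0, \dots, n-3\}$.\<close>

definition wuenschmann :: "nat \<Rightarrow> ((nat \<Rightarrow> real) \<Rightarrow> real) \<Rightarrow> nat \<Rightarrow> (nat \<Rightarrow> real) \<Rightarrow> real" where
  "wuenschmann n F k z =
     wue_a n F n (k - 1) z - (\<Sum>i<n. Fpart F i z * wue_a n F i (k - 1) z)"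

text \<open>
  The Wilczynski invariants of $y^{(n)} = p_{n-1} y^{(n-1)} + \dots + p_0 y$ are defined by
  bringing the equation to its Laguerre--Forsyth form
  $v^{(n)} = q_{n-3} v^{(n-3)} + \dots + q_0 v$ by a substitution
  $y(x) = \lambda(x)\, v(t)$, $t = \mu(x)$, and setting
  \[ \theta = (\mu')^w \sum_{m=0}^{w-3} (-1)^m \frac{(2w-m-2)!\,(n-w+m)!}{(w-m-1)!\,m!}
       \frac{\mathrm{d}^m q_{n-w+m}}{\mathrm{d}t^m}, \qquad w = 3, \dots, n. \]
  The result does not depend on the choice of the reduction and is a polynomial in the $p_i$ and
  their derivatives. To obtain this polynomial, write $u = \mu''/\mu'$, $\ell = \lambda'/\lambda$
  and $e_k = \lambda\,(\mu')^k\, \mathrm{d}^k v/\mathrm{d}t^k$, so that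
  $e_k' = (\ell + k u)\, e_k + e_{k+1}$. Then $y^{(i)} = \sum_k c_{ik} e_k$, and the equation becomes
  $e_n = \sum_{k<n} r_k e_k$ with $r_k = (\mu')^{n-k} q_k = \sum_{i<n} p_i c_{ik} - c_{nk}$.
  The condition $q_{n-1} = 0$ amounts to $\ell = p_{n-1}/n - (n-1)u/2$, and, given this, the
  condition $q_{n-2} = 0$ amounts to the Riccati equation $u' = u^2/2 + S$ with \<open>S\<close> as below.
  Hence every derivative can be computed formally in terms of the $p_i$, their derivatives and $u$.

  The invariants are defined for an arbitrary derivation \<open>D\<close> acting on functions of \<open>a :: 'a\<close>,
  so that the same polynomial can be evaluated with \<open>d/dx\<close> and with the total derivative.
  Functions of type \<^typ>\<open>'a \<Rightarrow> real \<Rightarrow> real\<close> depend on \<open>a\<close> and (polynomially) on \<open>u\<close>.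
\<close>

definition lf_S :: "nat \<Rightarrow> (('a \<Rightarrow> real) \<Rightarrow> 'a \<Rightarrow> real) \<Rightarrow> (nat \<Rightarrow> 'a \<Rightarrow> real) \<Rightarrow> 'a \<Rightarrow> real" where
  "lf_S n D p a =
     - 12 / (real n * ((real n)\<^sup>2 - 1)) *
       (p (n - 2) a + (real n - 1) / (2 * real n) * (p (n - 1) a)\<^sup>2
        - (real n - 1) / 2 * D (p (n - 1)) a)"

definition lf_l :: "nat \<Rightarrow> (nat \<Rightarrow> 'a \<Rightarrow> real) \<Rightarrow> 'a \<Rightarrow> real \<Rightarrow> real" where
  "lf_l n p a u = p (n - 1) a / real n - (real n - 1) / 2 * u"

text \<open>The extension of \<open>D\<close> to functions of \<open>a\<close> and \<open>u\<close> with $u' = u^2/2 + S$\<close>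

definition lf_deriv ::
    "nat \<Rightarrow> (('a \<Rightarrow> real) \<Rightarrow> 'a \<Rightarrow> real) \<Rightarrow> (nat \<Rightarrow> 'a \<Rightarrow> real) \<Rightarrow>
      ('a \<Rightarrow> real \<Rightarrow> real) \<Rightarrow> 'a \<Rightarrow> real \<Rightarrow> real" where
  "lf_deriv n D p g a u = D (\<lambda>b. g b u) a + (u\<^sup>2 / 2 + lf_S n D p a) * deriv (g a) u"

primrec lf_c ::
    "nat \<Rightarrow> (('a \<Rightarrow> real) \<Rightarrow> 'a \<Rightarrow> real) \<Rightarrow> (nat \<Rightarrow> 'a \<Rightarrow> real) \<Rightarrow>
      nat \<Rightarrow> nat \<Rightarrow> 'a \<Rightarrow> real \<Rightarrow> real" where
  "lf_c n D p 0 = (\<lambda>k a u. if k = 0 then 1 else 0)"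
| "lf_c n D p (Suc i) = (\<lambda>k a u.
     lf_deriv n D p (lf_c n D p i k) a u
     + (lf_l n p a u + real k * u) * lf_c n D p i k a u
     + (if k = 0 then 0 else lf_c n D p i (k - 1) a u))"

definition lf_r ::
    "nat \<Rightarrow> (('a \<Rightarrow> real) \<Rightarrow> 'a \<Rightarrow> real) \<Rightarrow> (nat \<Rightarrow> 'a \<Rightarrow> real) \<Rightarrow>
      nat \<Rightarrow> 'a \<Rightarrow> real \<Rightarrow> real" where
  "lf_r n D p k a u = (\<Sum>i<n. p i a * lf_c n D p i k a u) - lf_c n D p n k a u"

text \<open>
  \<open>lf_rd n D p k m\<close> is $(\mu')^{n-k+m}\, \mathrm{d}^m q_k/\mathrm{d}t^m$. If $f = (\mu')^s g(\mu)$, then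
  $(\mu')^{s+1} (\mathrm{d}g/\mathrm{d}t)(\mu) = f' - s u f$.
\<close>

primrec lf_rd ::
    "nat \<Rightarrow> (('a \<Rightarrow> real) \<Rightarrow> 'a \<Rightarrow> real) \<Rightarrow> (nat \<Rightarrow> 'a \<Rightarrow> real) \<Rightarrow>
      nat \<Rightarrow> nat \<Rightarrow> 'a \<Rightarrow> real \<Rightarrow> real" where
  "lf_rd n D p k 0 = lf_r n D p k"
| "lf_rd n D p k (Suc m) = (\<lambda>a u.
     lf_deriv n D p (lf_rd n D p k m) a u
     - (real n - real k + real m) * u * lf_rd n D p k m a u)"

text \<open>
  \<open>wilczynski n D p k\<close>, for $k = 1, \dots, n-2$, is the invariant $\theta_k$, of weight $w = k + 2$.
  Being independent of $u$, it is evaluated at $u = 0$.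
\<close>

definition wilczynski ::
    "nat \<Rightarrow> (('a \<Rightarrow> real) \<Rightarrow> 'a \<Rightarrow> real) \<Rightarrow> (nat \<Rightarrow> 'a \<Rightarrow> real) \<Rightarrow> nat \<Rightarrow> 'a \<Rightarrow> real" where
  "wilczynski n D p k a =
     (let w = k + 2 in
      \<Sum>m = 0..w - 3.
        (-1) ^ m * (fact (2 * w - m - 2) * fact (n - w + m)) / (fact (w - m - 1) * fact m)
        * lf_rd n D p (n - w + m) m a 0)"

text \<open>
  For a linear equation with coefficients \<open>p i :: real \<Rightarrow> real\<close> the classical invariants are
  \<open>wilczynski n deriv p\<close>; the Doubrov invariants replace $p_i$ by $F_i$ and \<open>d/dx\<close> by the total
  derivative.
\<close>

definition doubrov :: "nat \<Rightarrow> ((nat \<Rightarrow> real) \<Rightarrow> real) \<Rightarrow> nat \<Rightarrow> (nat \<Rightarrow> real) \<Rightarrow> real" where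
  "doubrov n F = wilczynski n (total_deriv n F) (Fpart F)"

end

theory Submission
  imports Defs
begin

text \<open>
  Both families of conditions say that, with the total derivative playing the role of $d/dx$, the
  operator $L = y^{(n)} - \sum_i F_i y^{(i)}$ is the $(n-1)$st symmetric power of a second order
  operator; they only differ in the basis in which the defect is expanded.

  On the Wuenschmann side the basis consists of the monomials $\mathbf{p}^{n-1-m}\mathbf{q}^m$,
  where $\mathbf{p}' = \mathbf{q}$ and $\mathbf{q}' = P\mathbf{p} + Q\mathbf{q}$, and the
  coefficients of $L(\mathbf{p}^{n-1})$ are the quantities called \<open>residual\<close> below.
  On the Laguerre--Forsyth side a function $\lambda v(\mu)$ is expanded in the
  $e_k = \lambda (\mu')^k v^{(k)}(\mu)$. The model solution is $v = (t - c)^{n-1}$; with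
  $\lambda = \rho^{n-1}$ it becomes $\mathbf{p}^{n-1}$ for $\mathbf{p} = \rho (\mu - c)$, and then
  \[ \mathbf{q} = \mathbf{p}' = x \mathbf{p} + \mathbf{g}, \qquad \mathbf{g} = \rho \mu', \qquad
     x = \ell/(n-1) = (Q - u)/2, \qquad
     e_k = \frac{(n-1)!}{(n-1-k)!}\, \mathbf{p}^{n-1-k} \mathbf{g}^k . \]
  The Riccati equation for \<open>u\<close> is exactly what makes this consistent with $\mathbf{q}' =
  P\mathbf{p} + Q\mathbf{q}$. Passing from one basis to the other is therefore the translation
  $\mathbf{q} = \mathbf{g} + x\mathbf{p}$, so that up to factorials the coefficients $c_{ik}$ are
  the Taylor coefficients at \<open>x\<close> of the polynomial $\sum_m a_{im} X^m$
  (\<open>lf_c_eq_taylor\<close>), and the same relation holds between the $r_k$ and the negatives of the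
  residuals (\<open>lf_r_eq_taylor\<close>).

  The two top residuals vanish identically, by the choice of \<open>Q\<close> and \<open>P\<close>. Going down from there,
  once all residuals of index greater than \<open>k\<close> vanish on \<open>U\<close>, the Taylor coefficient of index \<open>k\<close>
  is the residual of index \<open>k\<close> itself, whatever the value of \<open>u\<close>, and in the corresponding
  Doubrov invariant all terms except the first drop out. Hence that invariant is a nonzero
  multiple of that residual (\<open>doubrov_leading\<close>), and the two systems of equations are
  equivalent by induction.
\<close>

section \<open>The differential algebra generated by the right-hand side\<close>

text \<open>
  All coefficients in sight are built from \<open>F\<close>, its partial derivatives and the coordinates by ring
  operations. Generating an algebra from these, instead of working with all smooth functions,
  makes closure under partial derivatives a plain induction: it takes the product rule once,
  rather than for iterated derivatives. Membership only concerns values on \<open>U\<close>, since the product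
  and sum rules for \<open>pd\<close> hold only there.
\<close>

inductive_set jet_algebra ::
    "nat \<Rightarrow> ((nat \<Rightarrow> real) \<Rightarrow> real) \<Rightarrow> (nat \<Rightarrow> real) set \<Rightarrow> ((nat \<Rightarrow> real) \<Rightarrow> real) set"
  for n F U where
  partial: "set is \<subseteq> {..n} \<Longrightarrow> foldr pd is F \<in> jet_algebra n F U"
| coord: "(\<lambda>z. z j) \<in> jet_algebra n F U"
| const: "(\<lambda>_. c) \<in> jet_algebra n F U"
| add: "f \<in> jet_algebra n F U \<Longrightarrow> g \<in> jet_algebra n F U \<Longrightarrow> (\<lambda>z. f z + g z) \<in> jet_algebra n F U"
| mult: "f \<in> jet_algebra n F U \<Longrightarrow> g \<in> jet_algebra n F U \<Longrightarrow> (\<lambda>z. f z * g z) \<in> jet_algebra n F U"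
| cong: "f \<in> jet_algebra n F U \<Longrightarrow> (\<And>z. z \<in> U \<Longrightarrow> g z = f z) \<Longrightarrow> g \<in> jet_algebra n F U"

locale smooth_ode =
  fixes n :: nat and F :: "(nat \<Rightarrow> real) \<Rightarrow> real" and U :: "(nat \<Rightarrow> real) set"
  assumes order_ge_2: "n \<ge> 2"
    and open_domain: "openin (top_of_set (jet_space n)) U"
    and smooth: "smooth_on_jets n U F"
begin

abbreviation \<A> where "\<A> \<equiv> jet_algebra n F U"
abbreviation D where "D \<equiv> total_deriv n F"
abbreviation p where "p \<equiv> Fpart F"

lemma coordinate_line_in_domain:
  assumes "z \<in> U" "i \<le> n"
  shows "eventually (\<lambda>t. z(i := t) \<in> U) (nhds (z i))"
proof -
  obtain T where T: "open T" "U = jet_space n \<inter> T"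
    using open_domain by (auto simp: openin_open)
  have "continuous_on UNIV (\<lambda>t. z(i := t))"
  proof (rule continuous_on_coordinatewise_then_product)
    show "continuous_on UNIV (\<lambda>t. (z(i := t)) j)" for j
      by (cases "j = i") (simp_all add: continuous_on_id)
  qed
  then have "open ((\<lambda>t. z(i := t)) -` T)"
    using T(1) by (simp add: open_vimage)
  moreover have "z i \<in> (\<lambda>t. z(i := t)) -` T"
    using T assms by auto
  ultimately have "eventually (\<lambda>t. t \<in> (\<lambda>t. z(i := t)) -` T) (nhds (z i))"
    by (rule eventually_nhds_in_open)
  then show ?thesis
    by eventually_elim (use assms T(2) in \<open>auto simp: jet_space_def\<close>)
qed

text \<open>
  Partial derivatives are local along coordinate lines, and these stay in \<open>U\<close> near a point of \<open>U\<close>.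
  Through this, identities that hold on \<open>U\<close> can be differentiated.
\<close>

lemma partial_cong:
  assumes "z \<in> U" "i \<le> n" "\<And>w. w \<in> U \<Longrightarrow> f w = g w"
  shows "pd i f z = pd i g z"
    and "(\<lambda>t. f (z(i := t))) field_differentiable at (z i) \<longleftrightarrow>
         (\<lambda>t. g (z(i := t))) field_differentiable at (z i)"
proof -
  have ev: "eventually (\<lambda>t. f (z(i := t)) = g (z(i := t))) (nhds (z i))"
    using coordinate_line_in_domain[OF assms(1,2)] by eventually_elim (rule assms(3))
  show "pd i f z = pd i g z"
    unfolding pd_def by (rule deriv_cong_ev[OF ev refl])
  show "(\<lambda>t. f (z(i := t))) field_differentiable at (z i) \<longleftrightarrow>
        (\<lambda>t. g (z(i := t))) field_differentiable at (z i)"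
    unfolding field_differentiable_def using DERIV_cong_ev[OF refl ev refl] by blast
qed

lemma jet_algebra_closed_partial:
  assumes "f \<in> \<A>" "i \<le> n"
  shows "(\<forall>z\<in>U. (\<lambda>t. f (z(i := t))) field_differentiable at (z i)) \<and> pd i f \<in> \<A>"
  using assms(1)
proof induction
  case (partial "is")
  then have "set (i # is) \<subseteq> {..n}" using assms(2) by simp
  from jet_algebra.partial[OF this] have "pd i (foldr pd is F) \<in> \<A>" by simp
  then show ?case
    using partial assms(2) smooth unfolding smooth_on_jets_def by blast
next
  case (coord j)
  have "(\<lambda>t. (z(i := t)) j) field_differentiable at (z i)" for z :: "nat \<Rightarrow> real"
    by (cases "j = i") simp_all
  moreover have "pd i (\<lambda>z. z j) = (\<lambda>_. if j = i then 1 else 0)"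
    by (auto simp: pd_def fun_eq_iff)
  ultimately show ?case by (simp add: jet_algebra.const)
next
  case (const c)
  have "pd i (\<lambda>_. c) = (\<lambda>_. 0)" by (simp add: pd_def fun_eq_iff)
  then show ?case by (simp add: jet_algebra.const)
next
  case (add f g)
  have eq: "pd i (\<lambda>w. f w + g w) z = pd i f z + pd i g z" if "z \<in> U" for z
    using add that unfolding pd_def by (intro deriv_add) blast+
  have "(\<lambda>z. pd i f z + pd i g z) \<in> \<A>"
    using add by (intro jet_algebra.add) blast+
  then have "pd i (\<lambda>w. f w + g w) \<in> \<A>"
    by (rule jet_algebra.cong) (rule eq)
  then show ?case using add by (intro conjI ballI field_differentiable_add) blast+
next
  case (mult f g)
  have eq: "pd i (\<lambda>w. f w * g w) z = f z * pd i g z + pd i f z * g z" if "z \<in> U" for z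
  proof -
    have "deriv (\<lambda>t. f (z(i := t)) * g (z(i := t))) (z i) =
        f (z(i := z i)) * deriv (\<lambda>t. g (z(i := t))) (z i)
        + deriv (\<lambda>t. f (z(i := t))) (z i) * g (z(i := z i))"
      using mult that by (intro deriv_mult) blast+
    then show ?thesis by (simp add: pd_def)
  qed
  have "(\<lambda>z. f z * pd i g z + pd i f z * g z) \<in> \<A>"
    using mult by (intro jet_algebra.add jet_algebra.mult) blast+
  then have "pd i (\<lambda>w. f w * g w) \<in> \<A>"
    by (rule jet_algebra.cong) (rule eq)
  then show ?case using mult by (intro conjI ballI field_differentiable_mult) blast+
next
  case (cong f g)
  have "pd i f \<in> \<A>" using cong by blast
  then have "pd i g \<in> \<A>"
    by (rule jet_algebra.cong) (use cong partial_cong(1)[OF _ assms(2), of _ g f] in blast)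
  then show ?case
    using cong partial_cong(2)[OF _ assms(2), of _ g f] by blast
qed

lemma jet_algebra_sum:
  "finite I \<Longrightarrow> (\<And>j. j \<in> I \<Longrightarrow> f j \<in> \<A>) \<Longrightarrow> (\<lambda>z. \<Sum>j\<in>I. f j z) \<in> \<A>"
  by (induction I rule: finite_induct) (auto intro: jet_algebra.intros)

lemma jet_algebra_power: "f \<in> \<A> \<Longrightarrow> (\<lambda>z. f z ^ m) \<in> \<A>"
  by (induction m) (auto intro: jet_algebra.intros)

lemma jet_algebra_rhs: "F \<in> \<A>"
  using jet_algebra.partial[of "[]" n F U] by simp

lemma jet_algebra_Fpart: "i < n \<Longrightarrow> p i \<in> \<A>"
  using jet_algebra.partial[of "[Suc i]" n F U] by (simp add: Fpart_def)

lemma jet_algebra_total_deriv: "f \<in> \<A> \<Longrightarrow> D f \<in> \<A>"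
  unfolding total_deriv_def using order_ge_2
  by (intro jet_algebra.add jet_algebra.mult jet_algebra_sum jet_algebra.coord jet_algebra_rhs)
     (auto simp: jet_algebra_closed_partial)

lemma total_deriv_cong:
  assumes "z \<in> U" "\<And>w. w \<in> U \<Longrightarrow> f w = g w"
  shows "D f z = D g z"
proof -
  have "pd i f z = pd i g z" if "i \<le> n" for i
    using partial_cong(1)[OF assms(1) that assms(2)] .
  then show ?thesis
    unfolding total_deriv_def using order_ge_2 by (auto intro!: sum.cong)
qed

lemma total_deriv_const [simp]: "D (\<lambda>_. c) z = 0"
  by (simp add: total_deriv_def pd_def)

lemma total_deriv_linear_comb:
  assumes "\<And>i. i \<le> n \<Longrightarrow> pd i h z = c * pd i f z + d * pd i g z"
  shows "D h z = c * D f z + d * D g z"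
proof -
  have "(\<Sum>k = 1..n - 1. z (Suc k) * pd (Suc (k - 1)) h z) =
      (\<Sum>k = 1..n - 1. c * (z (Suc k) * pd (Suc (k - 1)) f z) + d * (z (Suc k) * pd (Suc (k - 1)) g z))"
    by (intro sum.cong refl) (auto simp: assms algebra_simps)
  then show ?thesis
    unfolding total_deriv_def using order_ge_2
    by (simp add: assms sum.distrib flip: sum_distrib_left) (simp add: algebra_simps)
qed

lemma total_deriv_mult:
  assumes "f \<in> \<A>" "g \<in> \<A>" "z \<in> U"
  shows "D (\<lambda>w. f w * g w) z = D f z * g z + f z * D g z"
proof -
  have "pd i (\<lambda>w. f w * g w) z = g z * pd i f z + f z * pd i g z" if "i \<le> n" for i
    using jet_algebra_closed_partial[OF assms(1) that] jet_algebra_closed_partial[OF assms(2) that]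
      assms(3) unfolding pd_def by (subst deriv_mult) auto
  from total_deriv_linear_comb[OF this] show ?thesis by simp
qed

lemma total_deriv_cmult: "f \<in> \<A> \<Longrightarrow> z \<in> U \<Longrightarrow> D (\<lambda>w. c * f w) z = c * D f z"
  using total_deriv_mult[OF jet_algebra.const] by simp

lemma total_deriv_add:
  assumes "f \<in> \<A>" "g \<in> \<A>" "z \<in> U"
  shows "D (\<lambda>w. f w + g w) z = D f z + D g z"
proof -
  have "pd i (\<lambda>w. f w + g w) z = 1 * pd i f z + 1 * pd i g z" if "i \<le> n" for i
    using jet_algebra_closed_partial[OF assms(1) that] jet_algebra_closed_partial[OF assms(2) that]
      assms(3) unfolding pd_def by (subst deriv_add) auto
  from total_deriv_linear_comb[OF this] show ?thesis by simp
qed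

lemma total_deriv_sum:
  assumes "finite I" "\<And>j. j \<in> I \<Longrightarrow> f j \<in> \<A>" "z \<in> U"
  shows "D (\<lambda>w. \<Sum>j\<in>I. f j w) z = (\<Sum>j\<in>I. D (f j) z)"
  using assms(1,2)
  by (induction I rule: finite_induct) (simp_all add: total_deriv_add jet_algebra_sum assms(3))

lemma total_deriv_power:
  assumes "f \<in> \<A>" "z \<in> U"
  shows "D (\<lambda>w. f w ^ m) z = real m * f z ^ (m - 1) * D f z"
proof (induction m)
  case (Suc m)
  have "D (\<lambda>w. f w * f w ^ m) z = D f z * f z ^ m + f z * (real m * f z ^ (m - 1) * D f z)"
    using total_deriv_mult[OF assms(1) jet_algebra_power[OF assms(1)] assms(2)] Suc by simp
  also have "\<dots> = real (Suc m) * f z ^ m * D f z"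
    by (cases m) (simp_all add: algebra_simps)
  finally show ?case by simp
qed simp

lemma jet_algebra_wue_Q: "wue_Q n F \<in> \<A>"
  unfolding wue_Q_def using order_ge_2
  by (intro jet_algebra.mult jet_algebra.const jet_algebra_Fpart) simp

lemma jet_algebra_wue_P: "wue_P n F \<in> \<A>"
proof -
  have "(\<lambda>z. 1 / (real n * ((real n)\<^sup>2 - 1)) *
       ((3 * real n - 1) * (real n - 2) / (real n * (real n - 1)) * (p (n - 1) z)\<^sup>2
        + 6 * p (n - 2) z
        + - (2 * (real n - 2)) * D (p (n - 1)) z)) \<in> \<A>"
    using order_ge_2
    by (intro jet_algebra.add jet_algebra.mult jet_algebra.const jet_algebra_power
        jet_algebra_Fpart jet_algebra_total_deriv) simp_all
  then show ?thesis by (rule jet_algebra.cong) (simp only: wue_P_def mult_minus_left diff_conv_add_uminus)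
qed

lemma jet_algebra_wue_a: "wue_a n F i k \<in> \<A>"
proof (induction i arbitrary: k)
  case 0
  show ?case by (simp add: jet_algebra.const)
next
  case (Suc i)
  have "(\<lambda>z. if k = 0 then 0 else (real n - real k) * wue_a n F i (k - 1) z) \<in> \<A>"
    using Suc by (cases "k = 0") (auto intro!: jet_algebra.mult jet_algebra.const)
  then show ?case
    unfolding wue_a.simps
    by (intro jet_algebra.add jet_algebra.mult jet_algebra.const jet_algebra_total_deriv Suc
        jet_algebra_wue_Q jet_algebra_wue_P)
qed

end

section \<open>Taylor coefficients of a shifted polynomial\<close>

text \<open>
  The coefficient of $X^k$ in $\sum_{m<n} a_m (X + x)^m$. The rules below express how the
  operations $X\,d/dX$, $d/dX$ and $(n-1)X - X^2\,d/dX$, which make up the recursion for $a_{ik}$,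
  act on these coefficients.
\<close>

definition taylor_coeff :: "nat \<Rightarrow> (nat \<Rightarrow> real) \<Rightarrow> real \<Rightarrow> nat \<Rightarrow> real" where
  "taylor_coeff n a x k = (\<Sum>m<n. real (m choose k) * a m * x ^ (m - k))"

lemma choose_Suc_right: "real (Suc k) * real (m choose Suc k) = (real m - real k) * real (m choose k)"
proof (cases "k \<le> m")
  case True
  have "Suc k * (m choose Suc k) = (m - k) * (m choose k)"
    by (simp only: binomial_absorption binomial_absorb_comp)
  then have "real (Suc k * (m choose Suc k)) = real ((m - k) * (m choose k))" by simp
  then show ?thesis using True by (simp only: of_nat_mult of_nat_diff)
qed (simp add: binomial_eq_0)

lemma choose_power_index:
  "real m * (real (m choose k) * x ^ (m - k)) =
   real k * (real (m choose k) * x ^ (m - k))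
   + real (Suc k) * x * (real (m choose Suc k) * x ^ (m - Suc k))"
proof (cases "k < m")
  case True
  then have x: "x ^ (m - k) = x * x ^ (m - Suc k)"
    by (simp flip: power_Suc add: Suc_diff_Suc)
  have "real k * (real (m choose k) * x ^ (m - k))
      + real (Suc k) * x * (real (m choose Suc k) * x ^ (m - Suc k)) =
      real k * (real (m choose k) * x ^ (m - k))
      + (real (Suc k) * real (m choose Suc k)) * (x * x ^ (m - Suc k))"
    by (simp only: mult_ac)
  also have "\<dots> = real m * (real (m choose k) * x ^ (m - k))"
    unfolding choose_Suc_right x[symmetric] by (simp add: algebra_simps)
  finally show ?thesis by (rule sym)
next
  case False
  then show ?thesis by (cases "m = k") (auto simp: binomial_eq_0)
qed

lemma taylor_coeff_index:
  "taylor_coeff n (\<lambda>m. real m * a m) x k =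
   real k * taylor_coeff n a x k + real (Suc k) * x * taylor_coeff n a x (Suc k)"
proof -
  have "taylor_coeff n (\<lambda>m. real m * a m) x k =
      (\<Sum>m<n. a m * (real m * (real (m choose k) * x ^ (m - k))))"
    unfolding taylor_coeff_def by (simp add: mult_ac)
  also have "\<dots> = real k * taylor_coeff n a x k + real (Suc k) * x * taylor_coeff n a x (Suc k)"
    unfolding taylor_coeff_def choose_power_index sum_distrib_left sum.distrib[symmetric]
    by (intro sum.cong refl) (simp only: ring_distribs mult_ac)
  finally show ?thesis .
qed

text \<open>
  The hypothesis \<open>a n = 0\<close> removes the boundary term: otherwise the derivative would involve the
  coefficient \<open>a n\<close>, which \<open>taylor_coeff n a\<close> does not see.
\<close>

lemma taylor_coeff_diff:
  assumes "a n = 0"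
  shows "taylor_coeff n (\<lambda>m. (real m + 1) * a (m + 1)) x k =
         real (Suc k) * taylor_coeff n a x (Suc k)"
proof -
  define g where "g m = real (m choose Suc k) * a m * x ^ (m - Suc k)" for m
  have "real (m choose k) * ((real m + 1) * a (m + 1)) * x ^ (m - k) = real (Suc k) * g (Suc m)" for m
  proof -
    have "real (Suc k * (Suc m choose Suc k)) = real (Suc m * (m choose k))"
      by (simp only: Suc_times_binomial_eq mult.commute[of "Suc k"])
    then have "real (Suc k) * real (Suc m choose Suc k) = (real m + 1) * real (m choose k)"
      by (simp only: of_nat_mult of_nat_Suc add.commute[of 1])
    moreover have "real (Suc k) * g (Suc m) =
        (real (Suc k) * real (Suc m choose Suc k)) * (a (m + 1) * x ^ (m - k))"
      by (simp only: g_def Suc_eq_plus1[symmetric] diff_Suc_Suc mult_ac)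
    ultimately show ?thesis by (simp only: mult_ac)
  qed
  then have "taylor_coeff n (\<lambda>m. (real m + 1) * a (m + 1)) x k = real (Suc k) * (\<Sum>m<n. g (Suc m))"
    unfolding taylor_coeff_def sum_distrib_left by simp
  also have "(\<Sum>m<n. g (Suc m)) = (\<Sum>m<Suc n. g m) - g 0"
    by (subst sum.lessThan_Suc_shift) simp
  also have "\<dots> = taylor_coeff n a x (Suc k)"
    using assms by (simp add: taylor_coeff_def g_def)
  finally show ?thesis .
qed

text \<open>
  The operator $(n-1)X - X^2\,d/dX$ preserves the polynomials of degree less than \<open>n\<close>, as
  the factor \<open>n - m\<close> vanishes at \<open>m = n\<close>. At $X + x$ in place of $X$ it reads
  $\bigl((n-1)X - X^2\,d/dX\bigr) + x\bigl((n-1) - 2X\,d/dX\bigr) - x^2\,d/dX$.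
\<close>

lemma taylor_coeff_raise:
  "taylor_coeff n (\<lambda>m. if m = 0 then 0 else (real n - real m) * a (m - 1)) x k =
   (if k = 0 then 0 else (real n - real k) * taylor_coeff n a x (k - 1))
   + (real n - 1 - 2 * real k) * x * taylor_coeff n a x k
   - real (Suc k) * x\<^sup>2 * taylor_coeff n a x (Suc k)"
proof -
  let ?T = "\<lambda>a. taylor_coeff n a x"
  define b where "b m = (real n - 1 - real m) * a m" for m
  define g where "g m = real (m choose k) * (if m = 0 then 0 else b (m - 1)) * x ^ (m - k)" for m
  have pascal: "g (Suc m) = x * (real (m choose k) * b m * x ^ (m - k)) +
      (if k = 0 then 0 else real (m choose (k - 1)) * b m * x ^ (m - (k - 1)))" for m
  proof (cases k)
    case (Suc k')
    show ?thesis
    proof (cases "k \<le> m")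
      case True
      then have "m - k' = Suc (m - k)" "Suc m - k = Suc (m - k)" using Suc by auto
      then show ?thesis using Suc by (simp add: g_def algebra_simps)
    next
      case False
      then have "m choose k = 0" by (simp add: binomial_eq_0)
      then show ?thesis using Suc by (simp add: g_def algebra_simps)
    qed
  qed (simp add: g_def)
  have b: "?T b j = (real n - 1 - real j) * ?T a j - real (Suc j) * x * ?T a (Suc j)" for j
  proof -
    have "?T b j = (real n - 1) * ?T a j - ?T (\<lambda>m. real m * a m) j"
      unfolding taylor_coeff_def b_def sum_distrib_left sum_subtractf[symmetric]
      by (intro sum.cong refl) (simp add: algebra_simps)
    then show ?thesis by (simp add: taylor_coeff_index algebra_simps)
  qed
  have "taylor_coeff n (\<lambda>m. if m = 0 then 0 else (real n - real m) * a (m - 1)) x k = (\<Sum>m<n. g m)"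
    unfolding taylor_coeff_def g_def b_def by (intro sum.cong refl) (auto simp: of_nat_diff)
  also have "\<dots> = (\<Sum>m<Suc n. g m)"
    by (cases n) (auto simp: g_def b_def)
  also have "\<dots> = (\<Sum>m<n. g (Suc m))"
    by (subst sum.lessThan_Suc_shift) (simp add: g_def)
  also have "\<dots> = x * ?T b k + (if k = 0 then 0 else ?T b (k - 1))"
    by (simp add: pascal sum.distrib taylor_coeff_def sum_distrib_left)
  also have "\<dots> = (if k = 0 then 0 else (real n - real k) * taylor_coeff n a x (k - 1))
   + (real n - 1 - 2 * real k) * x * taylor_coeff n a x k
   - real (Suc k) * x\<^sup>2 * taylor_coeff n a x (Suc k)"
    by (cases k) (simp_all add: b algebra_simps power2_eq_square)
  finally show ?thesis .
qed

lemma taylor_coeff_leading: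
  assumes "k < n" "\<And>m. k < m \<Longrightarrow> m < n \<Longrightarrow> a m = 0"
  shows "taylor_coeff n a x k = a k"
proof -
  have "taylor_coeff n a x k = (\<Sum>m<n. if m = k then a k else 0)"
    unfolding taylor_coeff_def
    by (intro sum.cong refl) (use assms in \<open>auto simp: binomial_eq_0 not_less_iff_gr_or_eq\<close>)
  then show ?thesis using assms by simp
qed


section \<open>The top entries of the Wuenschmann recursion\<close>

context smooth_ode
begin

text \<open>
  Besides the entries above the diagonal, those with \<open>k \<ge> n\<close> vanish: the factor \<open>n - k\<close>
  at \<open>k = n\<close> stops the recursion from leaving the polynomials of degree less than \<open>n\<close>.
\<close>

lemma wue_a_eq_0: "i < k \<or> n \<le> k \<Longrightarrow> z \<in> U \<Longrightarrow> wue_a n F i k z = 0"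
proof (induction i arbitrary: k z)
  case 0
  then show ?case using order_ge_2 by auto
next
  case (Suc i)
  have "D (wue_a n F i k) z = D (\<lambda>_. 0) z"
    using Suc by (intro total_deriv_cong) auto
  moreover have "wue_a n F i k z = 0" "wue_a n F i (k + 1) z = 0"
    using Suc by auto
  moreover have "(real n - real k) * wue_a n F i (k - 1) z = 0" if "k \<noteq> 0"
  proof (cases "k = n")
    case False
    then have "wue_a n F i (k - 1) z = 0" using that Suc by (intro Suc.IH) auto
    then show ?thesis by simp
  qed simp
  ultimately show ?case by simp
qed

text \<open>
  The falling factorial $(n-1)(n-2)\cdots(n-i)$: both the diagonal entry $a_{ii}$ and the factor
  between $e_i$ and $\mathbf{p}^{n-1-i}\mathbf{g}^i$.
\<close>

definition falling :: "nat \<Rightarrow> real" where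
  "falling i = fact (n - 1) / fact (n - 1 - i)"

lemma falling_Suc:
  assumes "Suc i < n"
  shows "falling (Suc i) = (real n - real (Suc i)) * falling i"
proof -
  have "n - 1 - i = Suc (n - 1 - Suc i)" using assms by simp
  then have "fact (n - 1 - i) = (real n - real (Suc i)) * fact (n - 1 - Suc i)"
    using assms by (simp add: of_nat_diff)
  then show ?thesis using assms by (simp add: falling_def)
qed

lemma falling_0 [simp]: "falling 0 = 1" by (simp add: falling_def)

lemma falling_nonzero [simp]: "falling i \<noteq> 0" by (simp add: falling_def)

lemma wue_a_diagonal: "i < n \<Longrightarrow> z \<in> U \<Longrightarrow> wue_a n F i i z = falling i"
proof (induction i arbitrary: z)
  case (Suc i)
  have "D (wue_a n F i (Suc i)) z = D (\<lambda>_. 0) z"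
    using Suc.prems by (intro total_deriv_cong) (auto simp: wue_a_eq_0)
  then show ?case using Suc by (simp add: wue_a_eq_0 falling_Suc)
qed simp

text \<open>
  Divided by \<open>falling i\<close>, the entries on the two diagonals below the main one obey first order
  recurrences in \<open>i\<close> with inhomogeneities polynomial in \<open>i\<close>, whose sums are the closed forms
  below.
\<close>

lemma wue_a_subdiagonal:
  "i < n \<Longrightarrow> z \<in> U \<Longrightarrow> wue_a n F (Suc i) i z = falling i * (real i * (real i + 1) / 2) * wue_Q n F z"
proof (induction i arbitrary: z)
  case 0
  then show ?case by (simp add: wue_a_eq_0)
next
  case (Suc i)
  have "D (wue_a n F (Suc i) (Suc i)) z = D (\<lambda>_. falling (Suc i)) z"
    using Suc.prems by (intro total_deriv_cong) (auto simp: wue_a_diagonal simp del: wue_a.simps)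
  then have "wue_a n F (Suc (Suc i)) (Suc i) z =
     real (Suc i) * wue_Q n F z * falling (Suc i)
     + (real n - real (Suc i)) * (falling i * (real i * (real i + 1) / 2) * wue_Q n F z)"
    using Suc by (subst wue_a.simps) (simp add: wue_a_eq_0 wue_a_diagonal del: wue_a.simps)
  also have "\<dots> = falling (Suc i) * (real (Suc i) * (real (Suc i) + 1) / 2) * wue_Q n F z"
    using Suc.prems by (simp add: falling_Suc field_simps)
  finally show ?case .
qed

lemma wue_a_second_subdiagonal:
  "Suc i < n \<Longrightarrow> z \<in> U \<Longrightarrow> wue_a n F (Suc (Suc i)) i z =
    falling i * (real i * (real i + 1) * (real i + 2) / 6 * D (wue_Q n F) z
      + real i * (real i + 1) * (real i + 2) * (3 * real i + 1) / 24 * (wue_Q n F z)\<^sup>2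
      + (real i + 1) * (real i + 2) * (3 * real n - 2 * real i - 3) / 6 * wue_P n F z)"
proof (induction i arbitrary: z)
  case 0
  have "D (wue_a n F (Suc 0) 0) z = D (\<lambda>_. 0) z"
    using 0 wue_a_subdiagonal[of 0] by (intro total_deriv_cong) (auto simp del: wue_a.simps)
  moreover have "wue_a n F (Suc 0) (Suc 0) z = real n - 1"
    using 0 wue_a_diagonal[of "Suc 0" z] by (simp add: falling_Suc del: wue_a.simps)
  moreover have "wue_a n F (Suc 0) 0 z = 0"
    using 0 wue_a_subdiagonal[of 0 z] by (simp del: wue_a.simps)
  ultimately show ?case
    by (subst wue_a.simps) (simp del: wue_a.simps)
next
  case (Suc i)
  let ?c = "falling (Suc i) * (real (Suc i) * (real (Suc i) + 1) / 2)"
  have "D (wue_a n F (Suc (Suc i)) (Suc i)) z = D (\<lambda>w. ?c * wue_Q n F w) z"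
    using Suc.prems by (intro total_deriv_cong) (auto simp: wue_a_subdiagonal simp del: wue_a.simps)
  also have "\<dots> = ?c * D (wue_Q n F) z"
    using Suc.prems by (intro total_deriv_cmult jet_algebra_wue_Q)
  finally have "wue_a n F (Suc (Suc (Suc i))) (Suc i) z =
     ?c * D (wue_Q n F) z
     + real (Suc i) * wue_Q n F z * (?c * wue_Q n F z)
     + (real n - real (Suc i)) * wue_a n F (Suc (Suc i)) i z
     + (real (Suc i) + 1) * wue_P n F z * falling (Suc (Suc i))"
    using Suc.prems
    by (subst wue_a.simps)
      (simp add: wue_a_subdiagonal wue_a_diagonal del: wue_a.simps)
  also have "\<dots> = falling (Suc i) * (real (Suc i) * (real (Suc i) + 1) * (real (Suc i) + 2) / 6 * D (wue_Q n F) z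
      + real (Suc i) * (real (Suc i) + 1) * (real (Suc i) + 2) * (3 * real (Suc i) + 1) / 24 * (wue_Q n F z)\<^sup>2
      + (real (Suc i) + 1) * (real (Suc i) + 2) * (3 * real n - 2 * real (Suc i) - 3) / 6 * wue_P n F z)"
    using Suc.prems
    by (simp add: Suc.IH falling_Suc field_simps power2_eq_square del: wue_a.simps)
  finally show ?case .
qed

text \<open>
  The coefficient of $\mathbf{p}^{n-1-m}\mathbf{q}^m$ in $L(\mathbf{p}^{n-1})$, indexed from \<open>0\<close>
  and including the two top ones.
\<close>

definition residual :: "nat \<Rightarrow> (nat \<Rightarrow> real) \<Rightarrow> real" where
  "residual m = wuenschmann n F (Suc m)"

lemma residual_eq: "residual m z = wue_a n F n m z - (\<Sum>i<n. p i z * wue_a n F i m z)"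
  by (simp add: residual_def wuenschmann_def)

text \<open>
  The top two residuals are the equations that determine \<open>Q\<close> and \<open>P\<close>.
\<close>

lemma residual_last:
  assumes "z \<in> U"
  shows "residual (n - 1) z = 0"
proof -
  have n: "Suc (n - 1) = n" using order_ge_2 by simp
  have "(\<Sum>i<n. p i z * wue_a n F i (n - 1) z) =
      (\<Sum>i<n. if i = n - 1 then p (n - 1) z * falling (n - 1) else 0)"
  proof (intro sum.cong refl)
    fix i assume "i \<in> {..<n}"
    then consider "i = n - 1" | "i < n - 1" by fastforce
    then show "p i z * wue_a n F i (n - 1) z = (if i = n - 1 then p (n - 1) z * falling (n - 1) else 0)"
      by cases (use assms order_ge_2 in \<open>simp_all add: wue_a_eq_0 wue_a_diagonal\<close>)
  qed
  also have "\<dots> = p (n - 1) z * falling (n - 1)" using order_ge_2 by simp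
  finally show ?thesis
    using wue_a_subdiagonal[of "n - 1" z] assms order_ge_2 unfolding residual_eq n
    by (simp add: wue_Q_def of_nat_diff)
qed

lemma residual_second_last:
  assumes "z \<in> U"
  shows "residual (n - 2) z = 0"
proof -
  have n: "Suc (Suc (n - 2)) = n" "Suc (n - 2) = n - 1" using order_ge_2 by auto
  have r: "real (n - 2) = real n - 2" using order_ge_2 by (simp add: of_nat_diff)
  have nz: "real n \<noteq> 0" "real n - 1 \<noteq> 0" "real n + 1 \<noteq> 0" using order_ge_2 by auto
  have sub: "wue_a n F (n - 1) (n - 2) z = falling (n - 2) * ((real n - 2) * (real n - 1) / 2) * wue_Q n F z"
    using wue_a_subdiagonal[of "n - 2" z] assms order_ge_2 unfolding n r by simp
  have "(\<Sum>i<n. p i z * wue_a n F i (n - 2) z) =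
      (\<Sum>i<n. (if i = n - 1 then p (n - 1) z * wue_a n F (n - 1) (n - 2) z else 0)
        + (if i = n - 2 then p (n - 2) z * falling (n - 2) else 0))"
  proof (intro sum.cong refl)
    fix i assume "i \<in> {..<n}"
    then consider "i = n - 1" | "i = n - 2" | "i < n - 2" by fastforce
    then show "p i z * wue_a n F i (n - 2) z =
        (if i = n - 1 then p (n - 1) z * wue_a n F (n - 1) (n - 2) z else 0)
        + (if i = n - 2 then p (n - 2) z * falling (n - 2) else 0)"
      by cases (use assms order_ge_2 in \<open>simp_all add: wue_a_eq_0 wue_a_diagonal\<close>)
  qed
  also have "\<dots> = p (n - 1) z * wue_a n F (n - 1) (n - 2) z + p (n - 2) z * falling (n - 2)"
    using order_ge_2 by (simp add: sum.distrib)
  finally have sum: "(\<Sum>i<n. p i z * wue_a n F i (n - 2) z) =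
    falling (n - 2) * (p (n - 1) z * ((real n - 2) * (real n - 1) / 2 * wue_Q n F z) + p (n - 2) z)"
    unfolding sub by (simp add: algebra_simps)
  have DQ: "D (wue_Q n F) z = 2 / (real n * (real n - 1)) * D (p (n - 1)) z"
    unfolding wue_Q_def using assms order_ge_2
    by (intro total_deriv_cmult jet_algebra_Fpart) auto
  have n2: "(real n)\<^sup>2 - 1 = (real n - 1) * (real n + 1)"
    by (simp add: power2_eq_square algebra_simps)
  have "residual (n - 2) z = falling (n - 2) * (
      ((real n - 2) * (real n - 1) * real n / 6 * D (wue_Q n F) z
      + (real n - 2) * (real n - 1) * real n * (3 * real n - 5) / 24 * (wue_Q n F z)\<^sup>2
      + (real n - 1) * real n * (real n + 1) / 6 * wue_P n F z)
      - (p (n - 1) z * ((real n - 2) * (real n - 1) / 2 * wue_Q n F z) + p (n - 2) z))"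
    using wue_a_second_subdiagonal[of "n - 2" z] assms order_ge_2 unfolding residual_eq n r sum
    by (simp add: right_diff_distrib)
  also have "\<dots> = 0"
    unfolding DQ unfolding wue_Q_def wue_P_def n2 using nz
    by (simp add: divide_simps) (simp add: power2_eq_square algebra_simps)
  finally show ?thesis .
qed

section \<open>Comparison with the Laguerre--Forsyth reduction\<close>

definition half_Q :: "(nat \<Rightarrow> real) \<Rightarrow> real" where
  "half_Q z = p (n - 1) z / (real n * (real n - 1))"

lemma jet_algebra_half_Q: "half_Q \<in> \<A>"
proof -
  have "(\<lambda>z. 1 / (real n * (real n - 1)) * p (n - 1) z) \<in> \<A>"
    using order_ge_2 by (intro jet_algebra.mult jet_algebra.const jet_algebra_Fpart) simp
  then show ?thesis by (rule jet_algebra.cong) (simp add: half_Q_def)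
qed

lemma total_deriv_half_Q: "z \<in> U \<Longrightarrow> D half_Q z = D (p (n - 1)) z / (real n * (real n - 1))"
  using total_deriv_cmult[of "p (n - 1)" z "1 / (real n * (real n - 1))"] order_ge_2
  by (simp add: jet_algebra_Fpart half_Q_def[abs_def])

lemma wue_Q_eq: "wue_Q n F z = 2 * half_Q z"
  by (simp add: wue_Q_def half_Q_def)

text \<open>
  This is the point at which the two second order equations are the same: with $x = (Q-u)/2$ and
  $u' = u^2/2 + S$ the vector $\mathbf{g} = \mathbf{q} - x\mathbf{p}$ satisfies
  $\mathbf{g}' = (x + u)\mathbf{g}$ if and only if \<open>P\<close> has this form.
\<close>

lemma wue_P_eq:
  assumes "z \<in> U"
  shows "wue_P n F z = D half_Q z - (half_Q z)\<^sup>2 - lf_S n D p z / 2"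
proof -
  have nz: "real n \<noteq> 0" "real n - 1 \<noteq> 0" "real n + 1 \<noteq> 0" using order_ge_2 by auto
  have n2: "(real n)\<^sup>2 - 1 = (real n - 1) * (real n + 1)"
    by (simp add: power2_eq_square algebra_simps)
  show ?thesis
    unfolding total_deriv_half_Q[OF assms] wue_P_def lf_S_def n2 unfolding half_Q_def using nz
    by (simp add: divide_simps) (simp add: power2_eq_square algebra_simps)
qed

lemma lf_l_eq: "lf_l n p z u = (real n - 1) * (half_Q z - u / 2)"
  using order_ge_2 by (simp add: lf_l_def half_Q_def field_simps)

text \<open>
  The recursion for $a_{ik}$, rewritten for the Taylor coefficients at \<open>x\<close>. The first two summands
  on the right are the derivative of such a coefficient along $x' = (Q/2)' - u'/2$; the other two are
  the remaining terms of the recursion for $c_{ik}$.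
\<close>

lemma taylor_wue_a_Suc:
  fixes u :: real
  assumes "z \<in> U"
  defines "x \<equiv> half_Q z - u / 2"
  shows "taylor_coeff n (\<lambda>m. wue_a n F (Suc i) m z) x k =
    taylor_coeff n (\<lambda>m. D (wue_a n F i m) z) x k
    + (D half_Q z - (u\<^sup>2 / 2 + lf_S n D p z) / 2) * (real (Suc k) * taylor_coeff n (\<lambda>m. wue_a n F i m z) x (Suc k))
    + ((real n - 1) * x + real k * u) * taylor_coeff n (\<lambda>m. wue_a n F i m z) x k
    + (if k = 0 then 0 else (real n - real k) * taylor_coeff n (\<lambda>m. wue_a n F i m z) x (k - 1))"
proof -
  let ?a = "\<lambda>m. wue_a n F i m z" and ?T = "\<lambda>a. taylor_coeff n a x"
  have "?T (\<lambda>m. wue_a n F (Suc i) m z) k =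
      ?T (\<lambda>m. D (wue_a n F i m) z) k
      + wue_Q n F z * ?T (\<lambda>m. real m * ?a m) k
      + ?T (\<lambda>m. if m = 0 then 0 else (real n - real m) * ?a (m - 1)) k
      + wue_P n F z * ?T (\<lambda>m. (real m + 1) * ?a (m + 1)) k"
    unfolding taylor_coeff_def sum_distrib_left sum.distrib[symmetric]
    by (intro sum.cong refl) (simp add: algebra_simps)
  also have "\<dots> = ?T (\<lambda>m. D (wue_a n F i m) z) k
      + (2 * x + u) * (real k * ?T ?a k + real (Suc k) * x * ?T ?a (Suc k))
      + ((if k = 0 then 0 else (real n - real k) * ?T ?a (k - 1))
        + (real n - 1 - 2 * real k) * x * ?T ?a k - real (Suc k) * x\<^sup>2 * ?T ?a (Suc k))
      + (D half_Q z - (x + u / 2)\<^sup>2 - lf_S n D p z / 2) * (real (Suc k) * ?T ?a (Suc k))"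
  proof -
    have "wue_a n F i n z = 0" using assms(1) by (simp add: wue_a_eq_0)
    moreover have "2 * half_Q z = 2 * x + u" "half_Q z = x + u / 2" by (simp_all add: x_def)
    ultimately show ?thesis
      by (simp only: taylor_coeff_index taylor_coeff_raise[of n ?a x k] taylor_coeff_diff[of ?a n x k]
          wue_Q_eq wue_P_eq[OF assms(1)])
  qed
  also have "\<dots> = ?T (\<lambda>m. D (wue_a n F i m) z) k
    + (D half_Q z - (u\<^sup>2 / 2 + lf_S n D p z) / 2) * (real (Suc k) * ?T ?a (Suc k))
    + ((real n - 1) * x + real k * u) * ?T ?a k
    + (if k = 0 then 0 else (real n - real k) * ?T ?a (k - 1))"
    by (simp add: power2_eq_square field_simps)
  finally show ?thesis .
qed

lemma total_deriv_taylor_wue_a: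
  assumes "z \<in> U"
  shows "D (\<lambda>w. taylor_coeff n (\<lambda>m. wue_a n F i m w) (half_Q w - c) k) z =
    taylor_coeff n (\<lambda>m. D (wue_a n F i m) z) (half_Q z - c) k
    + D half_Q z * (real (Suc k) * taylor_coeff n (\<lambda>m. wue_a n F i m z) (half_Q z - c) (Suc k))"
proof -
  have x: "(\<lambda>w. half_Q w + - c) \<in> \<A>"
    by (intro jet_algebra.add jet_algebra.const jet_algebra_half_Q)
  have Dx: "D (\<lambda>w. half_Q w + - c) z = D half_Q z"
    using total_deriv_add[OF jet_algebra_half_Q jet_algebra.const[of "- c"] assms] by simp
  let ?t = "\<lambda>m w. real (m choose k) * wue_a n F i m w"
  have t: "?t m \<in> \<A>" for m
    by (intro jet_algebra.mult jet_algebra.const jet_algebra_wue_a)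
  have "D (\<lambda>w. \<Sum>m<n. ?t m w * (half_Q w + - c) ^ (m - k)) z =
      (\<Sum>m<n. D (\<lambda>w. ?t m w * (half_Q w + - c) ^ (m - k)) z)"
    by (intro total_deriv_sum jet_algebra.mult t jet_algebra_power x assms) simp
  also have "\<dots> = (\<Sum>m<n. real (m choose k) * D (wue_a n F i m) z * (half_Q z - c) ^ (m - k)
      + D half_Q z * (real (Suc k) * (real (m choose Suc k) * wue_a n F i m z * (half_Q z - c) ^ (m - Suc k))))"
  proof (intro sum.cong refl)
    fix m
    have idx: "real (m choose k) * real (m - k) = real (Suc k) * real (m choose Suc k)"
      by (cases "k \<le> m")
        (simp_all add: choose_Suc_right of_nat_diff binomial_eq_0 mult.commute del: of_nat_Suc)
    have "D (\<lambda>w. ?t m w * (half_Q w + - c) ^ (m - k)) z =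
        real (m choose k) * D (wue_a n F i m) z * (half_Q z - c) ^ (m - k)
        + (real (m choose k) * real (m - k)) * (wue_a n F i m z * (half_Q z - c) ^ (m - Suc k) * D half_Q z)"
      using total_deriv_mult[OF t jet_algebra_power[OF x] assms, of m "m - k"]
        total_deriv_cmult[OF jet_algebra_wue_a assms] total_deriv_power[OF x assms, of "m - k"] Dx
      by simp
    then show "D (\<lambda>w. ?t m w * (half_Q w + - c) ^ (m - k)) z =
        real (m choose k) * D (wue_a n F i m) z * (half_Q z - c) ^ (m - k)
        + D half_Q z * (real (Suc k) * (real (m choose Suc k) * wue_a n F i m z * (half_Q z - c) ^ (m - Suc k)))"
      unfolding idx by (simp only: mult_ac)
  qed
  finally show ?thesis
    by (simp only: taylor_coeff_def sum.distrib sum_distrib_left diff_conv_add_uminus)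
qed

lemma taylor_coeff_has_derivative:
  "((\<lambda>u. taylor_coeff n a (y - u / 2) k) has_real_derivative
     - (real (Suc k) * taylor_coeff n a (y - u / 2) (Suc k)) / 2) (at u)"
proof -
  have "((\<lambda>u. real (m choose k) * a m * (y - u / 2) ^ (m - k)) has_real_derivative
      - (real (Suc k) * (real (m choose Suc k) * a m * (y - u / 2) ^ (m - Suc k))) / 2) (at u)" for m
  proof -
    have idx: "real (Suc k) * real (m choose Suc k) = real (m choose k) * real (m - k)"
      by (cases "k \<le> m")
        (simp_all add: choose_Suc_right of_nat_diff binomial_eq_0 mult.commute del: of_nat_Suc)
    have "((\<lambda>u. real (m choose k) * a m * (y - u / 2) ^ (m - k)) has_real_derivative
      - (real (m choose k) * real (m - k) * (a m * (y - u / 2) ^ (m - Suc k))) / 2) (at u)"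
      by (auto intro!: derivative_eq_intros)
    then show ?thesis unfolding idx[symmetric] by (simp only: mult_ac)
  qed
  then have "((\<lambda>u. \<Sum>m<n. real (m choose k) * a m * (y - u / 2) ^ (m - k)) has_real_derivative
      (\<Sum>m<n. - (real (Suc k) * (real (m choose Suc k) * a m * (y - u / 2) ^ (m - Suc k))) / 2)) (at u)"
    by (intro DERIV_sum)
  then show ?thesis
    by (simp only: taylor_coeff_def sum_distrib_left sum_divide_distrib sum_negf[symmetric])
qed

text \<open>
  The change of basis $\mathbf{q} = \mathbf{g} + x\mathbf{p}$ at the level of coefficients. Since
  the right-hand side is explicitly polynomial in \<open>u\<close> with coefficients in the jet algebra, this
  formula also justifies, inside its own induction, the differentiations in \<open>lf_deriv\<close>. The
  restriction \<open>k < n\<close> reflects that $e_n$ vanishes for $v = (t-c)^{n-1}$.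
\<close>

lemma lf_c_eq_taylor:
  "k < n \<Longrightarrow> z \<in> U \<Longrightarrow>
   lf_c n D p i k z u = taylor_coeff n (\<lambda>m. wue_a n F i m z) (half_Q z - u / 2) k / falling k"
proof (induction i arbitrary: k z u)
  case 0
  have "taylor_coeff n (\<lambda>m. wue_a n F 0 m z) (half_Q z - u / 2) k =
      (\<Sum>m<n. if m = 0 then (if k = 0 then 1 else 0) else 0)"
    unfolding taylor_coeff_def by (intro sum.cong refl) auto
  then show ?case using order_ge_2 by simp
next
  case (Suc i)
  let ?T = "\<lambda>w u. taylor_coeff n (\<lambda>m. wue_a n F i m w) (half_Q w - u / 2)"
  have "D (\<lambda>w. lf_c n D p i k w u) z = D (\<lambda>w. 1 / falling k * ?T w u k) z"
    using Suc by (intro total_deriv_cong) auto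
  also have "\<dots> = 1 / falling k * D (\<lambda>w. ?T w u k) z"
  proof (rule total_deriv_cmult)
    have "(\<lambda>w. \<Sum>m<n. real (m choose k) * wue_a n F i m w * (half_Q w + - (u / 2)) ^ (m - k)) \<in> \<A>"
      by (intro jet_algebra_sum jet_algebra.mult jet_algebra.const jet_algebra_wue_a
          jet_algebra_power jet_algebra.add jet_algebra_half_Q) simp
    then show "(\<lambda>w. ?T w u k) \<in> \<A>" by (simp add: taylor_coeff_def)
  qed (rule Suc.prems)
  finally have Dc: "D (\<lambda>w. lf_c n D p i k w u) z = D (\<lambda>w. ?T w u k) z / falling k" by simp
  have "lf_c n D p i k z = (\<lambda>u. ?T z u k / falling k)"
    using Suc by auto
  then have du: "deriv (lf_c n D p i k z) u = - (real (Suc k) * ?T z u (Suc k)) / 2 / falling k"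
    using DERIV_imp_deriv[OF DERIV_cdivide[OF taylor_coeff_has_derivative]] by simp
  have lower: "(if k = 0 then 0 else lf_c n D p i (k - 1) z u) =
      (if k = 0 then 0 else (real n - real k) * ?T z u (k - 1)) / falling k"
  proof (cases k)
    case (Suc k')
    then have "falling k = (real n - real k) * falling k'" "real n - real k \<noteq> 0"
      using falling_Suc[of k'] Suc.prems by auto
    then show ?thesis using Suc Suc.IH[of k' z u] Suc.prems by simp
  qed simp
  have "lf_c n D p (Suc i) k z u =
    (taylor_coeff n (\<lambda>m. D (wue_a n F i m) z) (half_Q z - u / 2) k
    + (D half_Q z - (u\<^sup>2 / 2 + lf_S n D p z) / 2) * (real (Suc k) * ?T z u (Suc k))
    + ((real n - 1) * (half_Q z - u / 2) + real k * u) * ?T z u k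
    + (if k = 0 then 0 else (real n - real k) * ?T z u (k - 1))) / falling k"
    using Suc.prems
    by (simp add: lf_deriv_def Dc du lower Suc.IH lf_l_eq total_deriv_taylor_wue_a
        add_divide_distrib del: of_nat_Suc) (simp add: field_simps)
  then show ?case using taylor_wue_a_Suc[OF Suc.prems(2)] by simp
qed

lemma lf_r_eq_taylor:
  assumes "k < n" "z \<in> U"
  shows "lf_r n D p k z u = - taylor_coeff n (\<lambda>m. residual m z) (half_Q z - u / 2) k / falling k"
proof -
  let ?x = "half_Q z - u / 2"
  have "taylor_coeff n (\<lambda>m. residual m z) ?x k = taylor_coeff n (\<lambda>m. wue_a n F n m z) ?x k
      - taylor_coeff n (\<lambda>m. \<Sum>i<n. p i z * wue_a n F i m z) ?x k"
    by (simp add: taylor_coeff_def residual_eq algebra_simps sum_subtractf)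
  also have "taylor_coeff n (\<lambda>m. \<Sum>i<n. p i z * wue_a n F i m z) ?x k =
      (\<Sum>i<n. p i z * taylor_coeff n (\<lambda>m. wue_a n F i m z) ?x k)"
    unfolding taylor_coeff_def sum_distrib_left sum_distrib_right
    by (subst sum.swap) (simp add: mult_ac)
  finally show ?thesis
    using assms by (simp add: lf_r_def lf_c_eq_taylor diff_divide_distrib sum_divide_distrib)
qed

lemma lf_rd_eq_0:
  assumes "\<And>z u. z \<in> U \<Longrightarrow> lf_r n D p k z u = 0"
  shows "z \<in> U \<Longrightarrow> lf_rd n D p k m z u = 0"
proof (induction m arbitrary: z u)
  case (Suc m)
  have "D (\<lambda>w. lf_rd n D p k m w u) z = D (\<lambda>_. 0) z"
    using Suc by (intro total_deriv_cong)
  moreover have "lf_rd n D p k m z = (\<lambda>_. 0)"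
    using Suc by auto
  ultimately show ?case by (simp add: lf_deriv_def)
qed (simp add: assms)

lemma lf_rd_eq_0_if_residual_eq_0:
  assumes "\<And>m z. k \<le> m \<Longrightarrow> m < n \<Longrightarrow> z \<in> U \<Longrightarrow> residual m z = 0" "z \<in> U" "k < n"
  shows "lf_rd n D p k j z u = 0"
proof (rule lf_rd_eq_0[OF _ assms(2)])
  show "lf_r n D p k w v = 0" if "w \<in> U" for w v
    using lf_r_eq_taylor[OF assms(3) that] taylor_coeff_leading[of k n "\<lambda>m. residual m w"] assms(1,3) that
    by simp
qed

text \<open>
  The invariant $\theta_k$ combines $r_{n-2-k}$ with derivatives of $r_j$ for \<open>n - 2 - k < j\<close>.
  Under the hypothesis these $r_j$ vanish for all points of \<open>U\<close> and all \<open>u\<close>, so their derivatives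
  vanish as well, although the invariant is evaluated at \<open>u = 0\<close> only.
\<close>

lemma doubrov_leading:
  assumes k: "k \<in> {1..n - 2}" and z: "z \<in> U"
    and W0: "\<And>m w. n - 2 - k < m \<Longrightarrow> m < n \<Longrightarrow> w \<in> U \<Longrightarrow> residual m w = 0"
  shows "\<exists>c. c \<noteq> 0 \<and> doubrov n F k z = c * residual (n - 2 - k) z"
proof -
  let ?w = "k + 2"
  let ?c = "\<lambda>m. (- 1) ^ m * (fact (2 * ?w - m - 2) * fact (n - ?w + m)) / (fact (?w - m - 1) * fact m) :: real"
  have idx: "n - ?w = n - 2 - k" "n - 2 - k < n" using k by auto
  have "doubrov n F k z = (\<Sum>m = 0..?w - 3. ?c m * lf_rd n D p (n - ?w + m) m z 0)"
    by (simp add: doubrov_def wilczynski_def)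
  also have "\<dots> = (\<Sum>m = 0..?w - 3. if m = 0 then ?c 0 * lf_r n D p (n - 2 - k) z 0 else 0)"
  proof (intro sum.cong refl)
    fix m assume m: "m \<in> {0..?w - 3}"
    have "lf_rd n D p (n - ?w + m) m z 0 = 0" if "m \<noteq> 0"
      using that m k z by (intro lf_rd_eq_0_if_residual_eq_0 W0) auto
    then show "?c m * lf_rd n D p (n - ?w + m) m z 0 =
        (if m = 0 then ?c 0 * lf_r n D p (n - 2 - k) z 0 else 0)"
      using idx(1) by (cases "m = 0") simp_all
  qed
  also have "\<dots> = ?c 0 * lf_r n D p (n - 2 - k) z 0" by simp
  also have "lf_r n D p (n - 2 - k) z 0 = - residual (n - 2 - k) z / falling (n - 2 - k)"
    using lf_r_eq_taylor[OF idx(2) z] taylor_coeff_leading[OF idx(2), of "\<lambda>m. residual m z"] W0 z by simp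
  finally have "doubrov n F k z = (- ?c 0 / falling (n - 2 - k)) * residual (n - 2 - k) z" by simp
  moreover have "- ?c 0 / falling (n - 2 - k) \<noteq> 0" by simp
  ultimately show ?thesis by blast
qed

end

theorem theorem3p3:
  fixes n :: nat and F :: "(nat \<Rightarrow> real) \<Rightarrow> real" and U :: "(nat \<Rightarrow> real) set"
  assumes "n \<ge> 2"
    and "openin (top_of_set (jet_space n)) U"
    and "smooth_on_jets n U F"
  shows "(\<forall>k\<in>{1..n - 2}. \<forall>z\<in>U. wuenschmann n F k z = 0) \<longleftrightarrow>
         (\<forall>k\<in>{1..n - 2}. \<forall>z\<in>U. doubrov n F k z = 0)"
proof -
  interpret smooth_ode n F U by standard (fact assms)+
  have last: "residual m z = 0" if "n - 2 \<le> m" "m < n" "z \<in> U" for m z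
  proof -
    have "m = n - 1 \<or> m = n - 2" using that by auto
    then show ?thesis using residual_last residual_second_last that by auto
  qed
  show ?thesis
  proof
    assume *: "\<forall>k\<in>{1..n - 2}. \<forall>z\<in>U. wuenschmann n F k z = 0"
    have W: "residual m z = 0" if "m < n" "z \<in> U" for m z
    proof (cases "n - 2 \<le> m")
      case False
      then have "Suc m \<in> {1..n - 2}" by auto
      then show ?thesis using * that by (simp add: residual_def)
    qed (use last that in auto)
    show "\<forall>k\<in>{1..n - 2}. \<forall>z\<in>U. doubrov n F k z = 0"
    proof (intro ballI)
      fix k z assume k: "k \<in> {1..n - 2}" and z: "z \<in> U"
      then have "n - 2 - k < n" by auto
      then show "doubrov n F k z = 0" using doubrov_leading[OF k z] W z by auto
    qed
  next
    assume *: "\<forall>k\<in>{1..n - 2}. \<forall>z\<in>U. doubrov n F k z = 0"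
    have W: "k \<le> n - 2 \<Longrightarrow> z \<in> U \<Longrightarrow> residual (n - 2 - k) z = 0" for k z
    proof (induction k arbitrary: z rule: less_induct)
      case (less k)
      show ?case
      proof (cases "k = 0")
        case False
        then have k: "k \<in> {1..n - 2}" using less.prems by auto
        have "residual m w = 0" if "n - 2 - k < m" "m < n" "w \<in> U" for m w
        proof (cases "n - 2 \<le> m")
          case False
          then have "m = n - 2 - (n - 2 - m)" "n - 2 - m < k" "n - 2 - m \<le> n - 2"
            using that by auto
          then show ?thesis using less.IH[of "n - 2 - m" w] that(3) by simp
        qed (use last that in auto)
        then show ?thesis using doubrov_leading[OF k less.prems(2)] * k less.prems(2) by auto
      qed (use last less.prems order_ge_2 in auto)
    qed
    show "\<forall>k\<in>{1..n - 2}. \<forall>z\<in>U. wuenschmann n F k z = 0"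
    proof (intro ballI)
      fix k z assume k: "k \<in> {1..n - 2}" and z: "z \<in> U"
      then have "n - 2 - (n - 1 - k) = k - 1" "Suc (k - 1) = k" "n - 1 - k \<le> n - 2" by auto
      then show "wuenschmann n F k z = 0" using W[of "n - 1 - k" z] z by (simp add: residual_def)
    qed
  qed
qed

end
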